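(* Let $n\in\{3,5,7,\dots\}$ and $\ell\ge 2$, and let $M=(M_{ab})_{a,b=1}^{\ell}$ be a square complex block matrix that is block $n$-diagonal with respect to $\ell$ principal layers labeled $a=1,2,\dots,\ell$. Split the layers into the two domains $\mathcal{D}_1=\{1,2,\dots,\ell-1\}$ and $\mathcal{D}_2=\{\ell\}$, assume that $M$ and the diagonal block $M_{\ell\ell}$ are invertible, and let $M_S^{(\ell-1)}$ be the Schur complement associated with this splitting, i.e. the block matrix indexed by the layers $a,b\in\{1,\dots,\ell-1\}$ with blocks $$(M_S^{(\ell-1)})_{ab}=M_{ab}-M_{a\ell}\,M_{\ell\ell}^{-1}\,M_{\ell b},\qquad a,b=1,\dots,\ell-1 .$$ Then $M_S^{(\ell-1)}$ is also block $n$-diagonal.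
   Context: A system with $\ell$ principal layers is modeled by a square complex block matrix $M=(M_{ab})_{a,b=1}^{\ell}$, where the block $M_{ab}$ has size $n_a\times n_b$ for given positive integers $n_1,\dots,n_\ell$ (so diagonal blocks are square). For odd $n\ge3$, a block matrix is block $n$-diagonal if its $(a,b)$ block is zero whenever $|a-b|>(n-1)/2$. For a splitting of the layers into two domains, write $M=\begin{pmatrix} M_{11} & M_{12} \\ M_{21} & M_{22} \end{pmatrix}$ for the induced $2\times 2$ block structure, where here the part with indices $i,j\in\{1,2\}$ collects the blocks with row layer in domain $i$ and column layer in domain $j$. When $M_{22}$ is invertible, one has the factorization $$M=\begin{pmatrix} I & M_{12}M_{22}^{-1} \\ 0 & I \end{pmatrix}\begin{pmatrix} M_S & 0 \\ 0 & M_{22} \end{pmatrix}\begin{pmatrix} I & 0 \\ M_{22}^{-1}M_{21} & I \end{pmatrix},\qquad M_S=M_{11}-M_{12}M_{22}^{-1}M_{21},$$ and $M_S$ is called the Schur complement. *)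

theory Defs
  imports "Jordan_Normal_Form.Gauss_Jordan_Elimination"
begin

text \<open>A block matrix over the layers \<open>1, \<dots>, l\<close>, where layer \<open>a\<close> has size \<open>d a\<close>, is an ordinary
  matrix whose rows and columns are grouped by layer.  Matrix indices start at \<open>0\<close>,
  layers are numbered from \<open>1\<close>; \<open>layers_dim d k\<close> is the total size of the layers \<open>1, \<dots>, k\<close>,
  so the rows of layer \<open>a\<close> start at index \<open>layers_dim d (a - 1)\<close>.\<close>

definition layers_dim :: "(nat \<Rightarrow> nat) \<Rightarrow> nat \<Rightarrow> nat" where
  "layers_dim d k = (\<Sum>a = 1..k. d a)"

definition block :: "(nat \<Rightarrow> nat) \<Rightarrow> 'a mat \<Rightarrow> nat \<Rightarrow> nat \<Rightarrow> 'a mat" where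
  "block d M a b =
     mat (d a) (d b) (\<lambda>(i, j). M $$ (layers_dim d (a - 1) + i, layers_dim d (b - 1) + j))"

definition block_diagonal :: "nat \<Rightarrow> (nat \<Rightarrow> nat) \<Rightarrow> nat \<Rightarrow> 'a::zero mat \<Rightarrow> bool" where
  "block_diagonal n d l M \<longleftrightarrow>
     M \<in> carrier_mat (layers_dim d l) (layers_dim d l) \<and>
     (\<forall>a\<in>{1..l}. \<forall>b\<in>{1..l}.
        \<bar>real a - real b\<bar> > (real n - 1) / 2 \<longrightarrow> block d M a b = 0\<^sub>m (d a) (d b))"

text \<open>The Schur complement for the splitting into the domains \<open>{1, \<dots>, k}\<close> and \<open>{k + 1, \<dots>, l}\<close>.
  It is meaningful only if \<open>M22\<close> is invertible: \<open>mat_inverse\<close> returns \<open>None\<close> otherwise.\<close>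

definition schur_complement :: "(nat \<Rightarrow> nat) \<Rightarrow> nat \<Rightarrow> 'a::field mat \<Rightarrow> 'a mat" where
  "schur_complement d k M =
     (case split_block M (layers_dim d k) (layers_dim d k) of
        (M11, M12, M21, M22) \<Rightarrow> M11 - M12 * the (mat_inverse M22) * M21)"

lemma layers_dim_Suc: "layers_dim d (Suc k) = layers_dim d k + d (Suc k)"
  by (simp add: layers_dim_def)

lemma layers_dim_mono: "j \<le> k \<Longrightarrow> layers_dim d j \<le> layers_dim d k"
  unfolding layers_dim_def by (rule sum_mono2) auto

lemma layers_dim_index_less:
  assumes "a \<in> {1..k}" "i < d a"
  shows "layers_dim d (a - 1) + i < layers_dim d k"
proof -
  have "layers_dim d a = layers_dim d (a - 1) + d a"
    using assms(1) layers_dim_Suc[of d "a - 1"] by simp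
  moreover have "layers_dim d a \<le> layers_dim d k"
    using assms(1) by (intro layers_dim_mono) simp
  ultimately show ?thesis using assms(2) by linarith
qed

text \<open>If the second domain is the single last layer, this is the blockwise formula
  \<open>M\<^sub>a\<^sub>b - M\<^sub>a\<^sub>l M\<^sub>l\<^sub>l\<^sup>-\<^sup>1 M\<^sub>l\<^sub>b\<close>.\<close>

lemma block_schur_complement:
  fixes M :: "'a::field mat"
  assumes l: "l \<ge> 2"
    and M: "M \<in> carrier_mat (layers_dim d l) (layers_dim d l)"
    and inv: "invertible_mat (block d M l l)"
    and a: "a \<in> {1..l - 1}" and b: "b \<in> {1..l - 1}"
  shows "block d (schur_complement d (l - 1) M) a b =
    block d M a b - block d M a l * the (mat_inverse (block d M l l)) * block d M l b"
proof -
  let ?s = "layers_dim d (l - 1)"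
  have dl: "layers_dim d l = ?s + d l"
    using l layers_dim_Suc[of d "l - 1"] by simp
  let ?D = "block d M l l"
  let ?B = "mat ?s (d l) (\<lambda>(i, j). M $$ (i, j + ?s))"
  let ?C = "mat (d l) ?s (\<lambda>(i, j). M $$ (i + ?s, j))"
  let ?A = "mat ?s ?s (\<lambda>ij. M $$ ij)"
  have D: "mat (d l) (d l) (\<lambda>(i, j). M $$ (i + ?s, j + ?s)) = ?D"
    by (rule eq_matI) (auto simp: block_def add.commute)
  have sc: "schur_complement d (l - 1) M = ?A - ?B * the (mat_inverse ?D) * ?C"
    using M dl D by (simp add: schur_complement_def split_block_def Let_def)
  have Dc: "?D \<in> carrier_mat (d l) (d l)" by (simp add: block_def)
  obtain V where V: "inverts_mat ?D V" "inverts_mat V ?D"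
    using inv unfolding invertible_mat_def by blast
  have "V \<in> carrier_mat (d l) (d l)"
  proof (rule carrier_matI)
    have "dim_col (?D * V) = d l" "dim_col (V * ?D) = dim_row V"
      using V Dc unfolding inverts_mat_def by auto
    then show "dim_row V = d l" "dim_col V = d l" using Dc by auto
  qed
  then have "?D \<in> Units (ring_mat TYPE('a) (d l) ())"
    using V Dc unfolding Units_def inverts_mat_def by (auto simp: ring_mat_simps)
  then obtain E where E: "mat_inverse ?D = Some E"
    using mat_inverse(1)[OF Dc] by fastforce
  then have Ec: "E \<in> carrier_mat (d l) (d l)" using mat_inverse(2)[OF Dc] by blast
  show ?thesis
  proof (rule eq_matI)
    fix i j
    assume "i < dim_row (block d M a b - block d M a l * the (mat_inverse ?D) * block d M l b)"
      and "j < dim_col (block d M a b - block d M a l * the (mat_inverse ?D) * block d M l b)"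
    then have ij: "i < d a" "j < d b" by (auto simp: block_def)
    have i: "layers_dim d (a - 1) + i < ?s" by (rule layers_dim_index_less[OF a]) (rule ij)
    have j: "layers_dim d (b - 1) + j < ?s" by (rule layers_dim_index_less[OF b]) (rule ij)
    have R: "row ?B (layers_dim d (a - 1) + i) = row (block d M a l) i"
      using i ij by (intro eq_vecI) (auto simp: block_def add.commute)
    have C: "col ?C (layers_dim d (b - 1) + j) = col (block d M l b) j"
      using j ij by (intro eq_vecI) (auto simp: block_def add.commute)
    have "row (?B * E) (layers_dim d (a - 1) + i) = row (block d M a l * E) i"
      using i ij R Ec by (intro eq_vecI) (auto simp: block_def)
    then show "block d (schur_complement d (l - 1) M) a b $$ (i, j) =
      (block d M a b - block d M a l * the (mat_inverse ?D) * block d M l b) $$ (i, j)"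
      unfolding sc E using i j ij C Ec by (simp add: block_def)
  qed (auto simp: block_def)
qed

end

theory Submission
  imports Defs
begin

text \<open>Eliminating the last layer changes block \<open>(a, b)\<close> only by the product of
  block \<open>(a, l)\<close>, the inverse of block \<open>(l, l)\<close> and block
  \<open>(l, b)\<close>. Since \<open>l\<close> is at the end of the chain, the smaller of
  \<open>a\<close> and \<open>b\<close> is at least as far from \<open>l\<close> as from the other
  index. So if \<open>(a, b)\<close> lies outside the band, one outer factor vanishes, and no
  fill-in occurs. \<open>block_schur_complement\<close> gives the blockwise formula.\<close>

lemma mat_inverse_in_carrier:
  fixes A :: "'a::field mat"
  assumes A: "A \<in> carrier_mat n n" and inv: "invertible_mat A"
  shows "the (mat_inverse A) \<in> carrier_mat n n"
proof -
  obtain V where V: "inverts_mat A V" "inverts_mat V A"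
    using inv unfolding invertible_mat_def by blast
  \<comment> \<open>\<open>inverts_mat\<close> prescribes no size for \<open>V\<close>; comparing
    dimensions in the two identities forces it to be square of size \<open>n\<close>, so
    \<open>A\<close> is a unit and \<open>mat_inverse\<close> cannot return
    \<open>None\<close>.\<close>
  have "dim_col (A * V) = n" "dim_col (V * A) = dim_row V"
    using V A unfolding inverts_mat_def by auto
  with A have "V \<in> carrier_mat n n" by auto
  then have "A \<in> Units (ring_mat TYPE('a) n ())"
    using V A unfolding Units_def inverts_mat_def by (auto simp: ring_mat_simps)
  then obtain E where "mat_inverse A = Some E"
    using mat_inverse(1)[OF A] by fastforce
  then show ?thesis using mat_inverse(2)[OF A] by simp
qed

text \<open>The outer dimensions of the product come from \<open>M12\<close> and \<open>M21\<close>,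
  so they do not depend on what \<open>mat_inverse\<close> returns.\<close>

lemma schur_complement_in_carrier:
  fixes M :: "'a::field mat"
  assumes "M \<in> carrier_mat (layers_dim d l) (layers_dim d l)" and "k \<le> l"
  shows "schur_complement d k M \<in> carrier_mat (layers_dim d k) (layers_dim d k)"
  using assms layers_dim_mono[of k l d]
  by (auto simp: schur_complement_def split_block_def Let_def)

theorem proposition3:
  fixes n l :: nat and d :: "nat \<Rightarrow> nat" and M :: "complex mat"
  assumes "odd n" and "n \<ge> 3"
    and "l \<ge> 2"
    and "\<And>a. a \<in> {1..l} \<Longrightarrow> d a > 0"
    and "block_diagonal n d l M"
    and "invertible_mat M"
    and "invertible_mat (block d M l l)"
  shows "block_diagonal n d (l - 1) (schur_complement d (l - 1) M)"
proof -
  have M: "M \<in> carrier_mat (layers_dim d l) (layers_dim d l)"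
    and zero: "\<And>a b. a \<in> {1..l} \<Longrightarrow> b \<in> {1..l} \<Longrightarrow> \<bar>real a - real b\<bar> > (real n - 1) / 2
      \<Longrightarrow> block d M a b = 0\<^sub>m (d a) (d b)"
    using \<open>block_diagonal n d l M\<close> unfolding block_diagonal_def by auto
  have carrier: "block d M a b \<in> carrier_mat (d a) (d b)" for a b
    by (simp add: block_def)
  define E where "E = the (mat_inverse (block d M l l))"
  \<comment> \<open>The size of \<open>E\<close> is what lets a product with a zero block collapse
    to a zero matrix of the right shape.\<close>
  have E: "E \<in> carrier_mat (d l) (d l)"
    unfolding E_def by (rule mat_inverse_in_carrier[OF carrier]) fact
  have "block d (schur_complement d (l - 1) M) a b = 0\<^sub>m (d a) (d b)"
    if a: "a \<in> {1..l - 1}" and b: "b \<in> {1..l - 1}"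
      and far: "\<bar>real a - real b\<bar> > (real n - 1) / 2" for a b
  proof -
    have al: "a \<in> {1..l}" and bl: "b \<in> {1..l}" and ll: "l \<in> {1..l}"
      and le: "real a \<le> real l" "real b \<le> real l"
      using a b by auto
    have "block d M a l * E * block d M l b = 0\<^sub>m (d a) (d b)"
    \<comment> \<open>the smaller of \<open>a\<close> and \<open>b\<close> is even farther from \<open>l\<close>\<close>
    proof (cases "a \<le> b")
      case True
      then have "block d M a l = 0\<^sub>m (d a) (d l)"
        using far le by (intro zero al ll) auto
      then show ?thesis using E carrier[of l b] by simp
    next
      case False
      then have "block d M l b = 0\<^sub>m (d l) (d b)"
        using far le by (intro zero bl ll) auto
      then show ?thesis using E carrier[of a l] by simp
    qed
    moreover have "block d M a b = 0\<^sub>m (d a) (d b)"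
      by (rule zero[OF al bl far])
    ultimately show ?thesis
      using block_schur_complement[OF \<open>l \<ge> 2\<close> M \<open>invertible_mat (block d M l l)\<close> a b]
      unfolding E_def by simp
  qed
  then show ?thesis
    unfolding block_diagonal_def using schur_complement_in_carrier[OF M, of "l - 1"] by auto
qed

end
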